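(* Let $L>0$, $\xi>0$, $M\ge 0$, $\delta>1$ be constants with $\xi=L\delta$. Let $f\in C(I\times\mathbb{R}^n\times\mathbb{R}^n,\mathbb{R}^n)$ and let $k(t,s,u)\in\mathbb{R}^n$ be continuous for $a\le s\le t<\infty$, $u\in\mathbb{R}^n$. Suppose that $$\|f(t,u,v)-f(t,\bar u,\bar v)\|\le M\big(\|u-\bar u\|+\|v-\bar v\|\big)\quad (t\in I,\ u,v,\bar u,\bar v\in\mathbb{R}^n),$$ $$\|k(t,s,u)-k(t,s,\bar u)\|\le L\|u-\bar u\|\quad (a\le s\le t<\infty,\ u,\bar u\in\mathbb{R}^n),$$ and $$d_1=\sup_{t\in I}\frac{1}{\mathbb{E}_\alpha[\xi(\psi(t)-\psi(a))^\alpha]}\left\|f\left(t,0,\frac{1}{\Gamma(\alpha)}\int_a^t N_\psi^\alpha(t,s)\,k(t,s,0)\,ds\right)\right\|<\infty .$$ If $M(1+1/\delta)<1$, then the integral equation $$x(t)=f\left(t,x(t),\frac{1}{\Gamma(\alpha)}\int_a^t N_\psi^\alpha(t,s)\,k(t,s,x(s))\,ds\right),\qquad t\in I,$$ has a unique solution $x\in C_\xi(I,\mathbb{R}^n)$.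
   Context: Let $a\in\mathbb{R}$, $I=[a,\infty)$, $0<\alpha\le 1$, and let $\|\cdot\|$ be a norm on $\mathbb{R}^n$. The function $\psi:I\to\mathbb{R}$ is increasing, positive on $(a,\infty)$, with continuous derivative $\psi'$ on $I$ and $\psi'(t)\ne 0$ for all $t$. Put $N_\psi^\alpha(t,s)=\psi'(s)(\psi(t)-\psi(s))^{\alpha-1}$. $\Gamma$ is the gamma function and $\mathbb{E}_\alpha(z)=\sum_{k=0}^\infty z^k/\Gamma(\alpha k+1)$ is the one-parameter Mittag-Leffler function. For $\xi>0$, $C_\xi(I,\mathbb{R}^n)$ is the set of continuous $x:I\to\mathbb{R}^n$ with $\sup_{t\in I}\|x(t)\|/\mathbb{E}_\alpha[\xi(\psi(t)-\psi(a))^\alpha]<\infty$. *)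

theory Defs
  imports "HOL-Analysis.Analysis"
begin

text \<open>
  An arbitrary norm on a real vector space, which need not be the norm of the type class;
  \<open>N x \<ge> 0\<close> follows from the three conditions.
\<close>

definition is_norm :: "('a::real_vector \<Rightarrow> real) \<Rightarrow> bool" where
  "is_norm N \<longleftrightarrow>
     (\<forall>x. N x = 0 \<longleftrightarrow> x = 0) \<and>
     (\<forall>c x. N (c *\<^sub>R x) = \<bar>c\<bar> * N x) \<and>
     (\<forall>x y. N (x + y) \<le> N x + N y)"

definition mittag_leffler :: "real \<Rightarrow> real \<Rightarrow> real" where
  "mittag_leffler \<alpha> z = (\<Sum>k. z ^ k / Gamma (\<alpha> * real k + 1))"

text \<open>
  In the following two definitions \<open>\<psi>'\<close> is the derivative of \<open>\<psi>\<close>. At \<open>s = t\<close> the kernel takes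
  the value \<open>0\<close> (as \<open>0 powr x = 0\<close>), which does not affect the integral over \<open>{a..t}\<close>.
\<close>

definition psi_kernel ::
  "(real \<Rightarrow> real) \<Rightarrow> (real \<Rightarrow> real) \<Rightarrow> real \<Rightarrow> real \<Rightarrow> real \<Rightarrow> real" where
  "psi_kernel \<psi> \<psi>' \<alpha> t s = \<psi>' s * (\<psi> t - \<psi> s) powr (\<alpha> - 1)"

definition psi_integral ::
  "real \<Rightarrow> (real \<Rightarrow> real) \<Rightarrow> (real \<Rightarrow> real) \<Rightarrow> real \<Rightarrow> real \<Rightarrow> (real \<Rightarrow> 'a) \<Rightarrow> 'a::euclidean_space" where
  "psi_integral a \<psi> \<psi>' \<alpha> t g =
     (1 / Gamma \<alpha>) *\<^sub>R integral {a..t} (\<lambda>s. psi_kernel \<psi> \<psi>' \<alpha> t s *\<^sub>R g s)"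

definition ml_weight :: "real \<Rightarrow> (real \<Rightarrow> real) \<Rightarrow> real \<Rightarrow> real \<Rightarrow> real \<Rightarrow> real" where
  "ml_weight a \<psi> \<alpha> \<xi> t = mittag_leffler \<alpha> (\<xi> * (\<psi> t - \<psi> a) powr \<alpha>)"

text \<open>
  Functions with domain \<open>{a..}\<close> are represented by extensional functions, so that equality of
  elements of the space is equality on \<open>{a..}\<close>.
\<close>

definition C_space ::
  "('a::euclidean_space \<Rightarrow> real) \<Rightarrow> real \<Rightarrow> (real \<Rightarrow> real) \<Rightarrow> real \<Rightarrow> real \<Rightarrow> (real \<Rightarrow> 'a) set" where
  "C_space N a \<psi> \<alpha> \<xi> =
     {x \<in> extensional {a..}. continuous_on {a..} x \<and>
        bdd_above ((\<lambda>t. N (x t) / ml_weight a \<psi> \<alpha> \<xi> t) ` {a..})}"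

end

theory Submission
  imports Defs "HOL-Real_Asymp.Real_Asymp"
begin

text \<open>
  The right-hand side of the equation defines an operator that contracts the distance
  \<open>sup N (x t - y t) / W t\<close>, with \<open>W\<close> the Mittag-Leffler weight, by the factor
  \<open>M (1 + 1 / \<delta>)\<close>: the fractional integral of \<open>W\<close> is \<open>(W - 1) / \<xi>\<close>, as one sees termwise from
  the Beta integral, so the Lipschitz constant \<open>L\<close> of the kernel costs only \<open>L / \<xi> = 1 / \<delta>\<close>.
  Picard iteration from \<open>0\<close> then converges locally uniformly, and finiteness of \<open>d\<^sub>1\<close> is what puts
  the limit into the weighted space. The substitution \<open>v = (\<psi> s - \<psi> a) / (\<psi> t - \<psi> a)\<close> turns the
  fractional integral into one over \<open>{0..1}\<close> with a fixed integrable weight, which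
  gives its continuity in \<open>t\<close> by dominated convergence.
\<close>

section \<open>Arbitrary norms on a Euclidean space\<close>

lemma is_norm_nonneg:
  assumes "is_norm N"
  shows "N x \<ge> 0"
proof -
  have "N (x + (-1) *\<^sub>R x) \<le> N x + N ((-1) *\<^sub>R x)" "N ((-1) *\<^sub>R x) = \<bar>-1\<bar> * N x" "N 0 = 0"
    using assms unfolding is_norm_def by blast+
  thus ?thesis by simp
qed

lemma is_norm_minus_commute:
  assumes "is_norm N"
  shows "N (x - y) = N (y - x)"
proof -
  have "N ((-1) *\<^sub>R (x - y)) = \<bar>-1\<bar> * N (x - y)"
    using assms unfolding is_norm_def by blast
  thus ?thesis by simp
qed

lemma is_norm_diff_triangle:
  assumes "is_norm N"
  shows "N (x - z) \<le> N (x - y) + N (y - z)"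
proof -
  have "N ((x - y) + (y - z)) \<le> N (x - y) + N (y - z)"
    using assms unfolding is_norm_def by blast
  thus ?thesis by simp
qed

lemma is_norm_sum_le:
  assumes "is_norm N"
  shows "N (\<Sum>i\<in>A. g i) \<le> (\<Sum>i\<in>A. N (g i))"
proof (induction A rule: infinite_finite_induct)
  case (insert x F)
  have "N (g x + (\<Sum>i\<in>F. g i)) \<le> N (g x) + N (\<Sum>i\<in>F. g i)"
    using assms unfolding is_norm_def by blast
  with insert show ?case by simp
qed (use assms[unfolded is_norm_def, THEN conjunct1, rule_format, of 0] in auto)

text \<open>Coordinates with respect to \<open>Basis\<close> are at most \<open>norm x\<close> in
  absolute value, so subadditivity and homogeneity give the bound. Continuity of \<open>N\<close>
  follows from it.\<close>

lemma is_norm_le_norm: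
  fixes N :: "'a::euclidean_space \<Rightarrow> real"
  assumes "is_norm N"
  obtains B where "B > 0" "\<And>x. N x \<le> B * norm x"
proof
  let ?B = "1 + (\<Sum>b\<in>Basis. N b)"
  show "?B > 0"
    by (intro add_pos_nonneg sum_nonneg) (auto intro: is_norm_nonneg assms)
  fix x :: 'a
  have "N x = N (\<Sum>b\<in>Basis. (x \<bullet> b) *\<^sub>R b)"
    by (simp add: euclidean_representation)
  also have "\<dots> \<le> (\<Sum>b\<in>Basis. N ((x \<bullet> b) *\<^sub>R b))"
    by (rule is_norm_sum_le[OF assms])
  also have "\<dots> = (\<Sum>b\<in>Basis. \<bar>x \<bullet> b\<bar> * N b)"
    using assms by (simp add: is_norm_def)
  also have "\<dots> \<le> (\<Sum>b\<in>Basis. norm x * N b)"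
    by (intro sum_mono mult_right_mono) (auto simp: Basis_le_norm is_norm_nonneg assms)
  also have "\<dots> \<le> ?B * norm x"
    by (simp add: sum_distrib_left algebra_simps)
  finally show "N x \<le> ?B * norm x" .
qed

lemma is_norm_continuous_on:
  fixes N :: "'a::euclidean_space \<Rightarrow> real"
  assumes "is_norm N"
  shows "continuous_on A N"
proof -
  obtain B where B: "B > 0" "\<And>x. N x \<le> B * norm x"
    using is_norm_le_norm[OF assms] by blast
  have "dist (N x) (N y) \<le> B * dist x y" for x y
    using is_norm_diff_triangle[OF assms, of x 0 y] is_norm_diff_triangle[OF assms, of y 0 x]
      is_norm_minus_commute[OF assms, of x y] B(2)[of "x - y"]
    by (auto simp: dist_norm)
  hence "B-lipschitz_on A N"
    using B(1) by (intro lipschitz_onI) auto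
  thus ?thesis by (rule lipschitz_on_continuous_on)
qed

text \<open>On the compact unit sphere the continuous function \<open>N\<close> attains a minimum,
  which is positive since \<open>N\<close> vanishes only at 0. Homogeneity carries the bound to all
  vectors.\<close>

lemma norm_le_is_norm:
  fixes N :: "'a::euclidean_space \<Rightarrow> real"
  assumes "is_norm N"
  obtains B where "B > 0" "\<And>x. norm x \<le> B * N x"
proof -
  have "compact (sphere 0 1 :: 'a set)" "sphere 0 1 \<noteq> ({} :: 'a set)"
    by auto
  then obtain z :: 'a where z: "norm z = 1" "\<And>y. norm y = 1 \<Longrightarrow> N z \<le> N y"
    using continuous_attains_inf[of "sphere 0 1" N] is_norm_continuous_on[OF assms] by auto
  have "N z \<noteq> 0" using assms z(1) by (auto simp: is_norm_def)
  hence pos: "N z > 0" using is_norm_nonneg[OF assms, of z] by linarith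
  have "norm x \<le> inverse (N z) * N x" for x
  proof (cases "x = 0")
    case False
    have "N z \<le> N ((1 / norm x) *\<^sub>R x)" using False by (intro z(2)) auto
    also have "\<dots> = N x / norm x" using assms by (auto simp: is_norm_def)
    finally show ?thesis using False pos by (simp add: field_simps)
  qed (use is_norm_nonneg[OF assms] pos in auto)
  with pos show ?thesis by (intro that[of "inverse (N z)"]) auto
qed

text \<open>Subadditivity and homogeneity give the inequality for every Riemann sum. Both sides are
  limits of such sums along the division filter, the left one by continuity of
  \<open>N\<close>.\<close>

lemma is_norm_integral_le:
  fixes g :: "real \<Rightarrow> 'a::euclidean_space"
  assumes N: "is_norm N" and g: "g integrable_on {a..b}" and Ng: "(\<lambda>x. N (g x)) integrable_on {a..b}"
  shows "N (integral {a..b} g) \<le> integral {a..b} (\<lambda>x. N (g x))"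
proof -
  let ?F = "division_filter (cbox a b)"
  have 1: "((\<lambda>p. N (\<Sum>(x,k)\<in>p. measure lborel k *\<^sub>R g x)) \<longlongrightarrow> N (integral {a..b} g)) ?F"
  proof (rule continuous_on_tendsto_compose[OF is_norm_continuous_on[OF N, of UNIV]])
    show "((\<lambda>p. \<Sum>(x,k)\<in>p. measure lborel k *\<^sub>R g x) \<longlongrightarrow> integral {a..b} g) ?F"
      using g by (simp only: has_integral_cbox[symmetric]) (simp add: has_integral_integral)
  qed auto
  have 2: "((\<lambda>p. \<Sum>(x,k)\<in>p. measure lborel k *\<^sub>R N (g x)) \<longlongrightarrow> integral {a..b} (\<lambda>x. N (g x))) ?F"
    using Ng by (simp only: has_integral_cbox[symmetric]) (simp add: has_integral_integral)
  have "N (\<Sum>(x,k)\<in>p. measure lborel k *\<^sub>R g x) \<le> (\<Sum>(x,k)\<in>p. measure lborel k *\<^sub>R N (g x))" for p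
  proof -
    have "N (\<Sum>(x,k)\<in>p. measure lborel k *\<^sub>R g x) \<le> (\<Sum>z\<in>p. N (case z of (x,k) \<Rightarrow> measure lborel k *\<^sub>R g x))"
      by (rule is_norm_sum_le[OF N])
    also have "\<dots> = (\<Sum>(x,k)\<in>p. measure lborel k *\<^sub>R N (g x))"
      using N by (intro sum.cong) (auto simp: is_norm_def)
    finally show ?thesis .
  qed
  thus ?thesis
    by (intro tendsto_le[OF _ 2 1] division_filter_not_empty always_eventually allI)
qed

section \<open>The Mittag-Leffler function\<close>

text \<open>Log-convexity of \<Gamma>: \<open>x + 1\<close> is the convex combination of
  \<open>x + \<alpha>\<close> and \<open>x + \<alpha> + 1\<close> with weights \<alpha> and
  \<open>1 - \<alpha>\<close>, and the functional equation removes both shifts by 1. The bound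
  decays like \<open>x powr (- \<alpha>)\<close>.\<close>

lemma Gamma_ratio_le:
  fixes x \<alpha> :: real
  assumes "x > 0" "0 < \<alpha>" "\<alpha> \<le> 1"
  shows "Gamma x / Gamma (x + \<alpha>) \<le> (x + \<alpha>) powr (1 - \<alpha>) / x"
proof -
  define G where "G = (\<lambda>x::real. ln (Gamma x))"
  have "(ln \<circ> Gamma) ((1 - (1 - \<alpha>)) *\<^sub>R (x + \<alpha>) + (1 - \<alpha>) *\<^sub>R (x + \<alpha> + 1))
      \<le> (1 - (1 - \<alpha>)) * (ln \<circ> Gamma) (x + \<alpha>) + (1 - \<alpha>) * (ln \<circ> Gamma) (x + \<alpha> + 1)"
    using assms by (intro convex_onD[OF log_convex_Gamma_real]) auto
  also have "(1 - (1 - \<alpha>)) *\<^sub>R (x + \<alpha>) + (1 - \<alpha>) *\<^sub>R (x + \<alpha> + 1) = x + 1"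
    by (simp add: algebra_simps)
  finally have le: "G (x + 1) \<le> \<alpha> * G (x + \<alpha>) + (1 - \<alpha>) * G (x + \<alpha> + 1)"
    by (simp add: G_def)
  have step: "G (y + 1) = ln y + G y" if "y > 0" for y
  proof -
    have "y \<notin> \<int>\<^sub>\<le>\<^sub>0" using that by (auto elim!: nonpos_Ints_cases)
    with that show ?thesis using Gamma_real_pos[OF that] by (simp add: G_def Gamma_plus1 ln_mult_pos)
  qed
  have "Gamma x / Gamma (x + \<alpha>) = exp (G x - G (x + \<alpha>))"
    using assms by (simp add: G_def exp_diff)
  also have "G x - G (x + \<alpha>) \<le> (1 - \<alpha>) * ln (x + \<alpha>) - ln x"
    using le step[of x] step[of "x + \<alpha>"] assms by (simp add: algebra_simps)
  also have "exp \<dots> = (x + \<alpha>) powr (1 - \<alpha>) / x"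
    using assms by (simp add: exp_diff powr_def)
  finally show ?thesis by simp
qed

text \<open>Ratio test: with \<open>x = \<alpha> * real k + 1\<close>, consecutive terms have ratio
  \<open>z * Gamma x / Gamma (x + \<alpha>)\<close>, which tends to 0 by the preceding
  bound.\<close>

lemma mittag_leffler_summable:
  fixes \<alpha> z :: real
  assumes "0 < \<alpha>" "\<alpha> \<le> 1"
  shows "summable (\<lambda>k. z ^ k / Gamma (\<alpha> * real k + 1))"
proof -
  have "((\<lambda>k. (\<alpha> * real k + 1 + \<alpha>) powr (1 - \<alpha>) / (\<alpha> * real k + 1)) \<longlongrightarrow> 0) at_top"
    using assms(1) by real_asymp
  \<comment> \<open>Multiplied by \<open>\<bar>z\<bar>\<close>, this threshold stays below 1/2;
    adding 1 to \<open>\<bar>z\<bar>\<close> avoids division by zero at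
    \<open>z = 0\<close>.\<close>
  hence "\<forall>\<^sub>F k in at_top. (\<alpha> * real k + 1 + \<alpha>) powr (1 - \<alpha>) / (\<alpha> * real k + 1) < 1 / (2 * (\<bar>z\<bar> + 1))"
    by (rule order_tendstoD) (simp add: add_nonneg_pos)
  then obtain n where n: "\<And>k. k \<ge> n \<Longrightarrow>
      (\<alpha> * real k + 1 + \<alpha>) powr (1 - \<alpha>) / (\<alpha> * real k + 1) < 1 / (2 * (\<bar>z\<bar> + 1))"
    by (auto simp: eventually_at_top_linorder)
  show ?thesis
  proof (rule summable_ratio_test[of "1/2" n])
    fix k assume "k \<ge> n"
    define x where "x = \<alpha> * real k + 1"
    have x: "x > 0" "\<alpha> * real (Suc k) + 1 = x + \<alpha>"
      using assms by (auto simp: x_def algebra_simps intro: add_pos_nonneg)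
    have "Gamma x / Gamma (x + \<alpha>) \<le> 1 / (2 * (\<bar>z\<bar> + 1))"
      using Gamma_ratio_le[OF x(1) assms] n[OF \<open>k \<ge> n\<close>] by (simp add: x_def)
    hence "\<bar>z\<bar> * (Gamma x / Gamma (x + \<alpha>)) \<le> \<bar>z\<bar> * (1 / (2 * (\<bar>z\<bar> + 1)))"
      by (rule mult_left_mono) auto
    also have "\<dots> \<le> 1 / 2" by (simp add: field_simps)
    finally have "\<bar>z\<bar> * (Gamma x / Gamma (x + \<alpha>)) * (\<bar>z\<bar> ^ k / Gamma x) \<le> 1 / 2 * (\<bar>z\<bar> ^ k / Gamma x)"
      using x by (intro mult_right_mono) auto
    moreover have "Gamma x > 0" "Gamma (x + \<alpha>) > 0" using x assms by auto
    ultimately show "norm (z ^ Suc k / Gamma (\<alpha> * real (Suc k) + 1))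
        \<le> 1 / 2 * norm (z ^ k / Gamma (\<alpha> * real k + 1))"
      unfolding x(2) x_def[symmetric]
      by (simp add: abs_mult power_abs mult_ac)
  qed simp
qed

lemma mittag_leffler_continuous_on:
  assumes "0 < \<alpha>" "\<alpha> \<le> 1"
  shows "continuous_on A (mittag_leffler \<alpha>)"
proof -
  have "isCont (\<lambda>x. \<Sum>n. inverse (Gamma (\<alpha> * real n + 1)) * x ^ n) z" for z
    using mittag_leffler_summable[OF assms]
    by (intro isCont_powser_converges_everywhere) (simp add: field_simps)
  thus ?thesis
    by (auto intro!: continuous_at_imp_continuous_on simp: mittag_leffler_def[abs_def] field_simps)
qed

lemma mittag_leffler_partial_le:
  assumes "0 < \<alpha>" "\<alpha> \<le> 1" "z \<ge> 0" "finite A"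
  shows "(\<Sum>k\<in>A. z ^ k / Gamma (\<alpha> * real k + 1)) \<le> mittag_leffler \<alpha> z"
  unfolding mittag_leffler_def using assms
  by (intro sum_le_suminf mittag_leffler_summable) (auto intro!: divide_nonneg_pos Gamma_real_pos add_nonneg_pos)

text \<open>The term for \<open>k = 0\<close> is already 1. This is what makes the weight
  positive.\<close>

lemma mittag_leffler_ge_1:
  assumes "0 < \<alpha>" "\<alpha> \<le> 1" "z \<ge> 0"
  shows "mittag_leffler \<alpha> z \<ge> 1"
  using mittag_leffler_partial_le[OF assms, of "{0}"] by simp

section \<open>Contractions in a weighted supremum distance\<close>

text \<open>Continuity is local: near \<open>t\<close> the half-line and \<open>{a..t+1}\<close>
  coincide. Uniform limits and the weighted integrals below are controlled on compact intervals
  only.\<close>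

lemma continuous_on_atLeast:
  fixes h :: "real \<Rightarrow> 'a::topological_space"
  assumes "\<And>T. T \<ge> a \<Longrightarrow> continuous_on {a..T} h"
  shows "continuous_on {a..} h"
  unfolding continuous_on_eq_continuous_within
proof
  fix t assume t: "t \<in> {a..}"
  have "continuous (at t within {a..t+1}) h"
    using assms[of "t+1"] t by (auto simp: continuous_on_eq_continuous_within)
  moreover have "at t within {a..t+1} = at t within {a..}"
    by (rule at_within_nhd[of _ "{..<t+1}"]) auto
  ultimately show "continuous (at t within {a..}) h" by simp
qed

lemma geometric_bound_eq_zero:
  fixes z C q :: real
  assumes "0 \<le> q" "q < 1" "0 \<le> z" "\<And>n. z \<le> C * q ^ n"
  shows "z = 0"
proof -
  have "(\<lambda>n. C * q ^ n) \<longlonglongrightarrow> C * 0"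
    using assms by (intro tendsto_intros) auto
  hence "z \<le> C * 0" using assms(4) by (intro LIMSEQ_le_const) auto
  with assms(3) show ?thesis by simp
qed

text \<open>The weighted distance is never formed as a supremum; a constant \<open>C\<close> with
  \<open>N (x t - y t) \<le> C * W t\<close> stands for it. Each application of \<open>T\<close> to
  two fixed points improves \<open>C\<close> by the factor \<open>q\<close>, so their difference
  vanishes.\<close>

lemma weighted_contraction_unique:
  fixes N :: "'a::euclidean_space \<Rightarrow> real" and W :: "real \<Rightarrow> real"
  assumes N: "is_norm N" and q: "0 \<le> q" "q < 1"
    and contr: "\<And>x y C. continuous_on {a..} x \<Longrightarrow> continuous_on {a..} y \<Longrightarrow> C \<ge> 0 \<Longrightarrow>
        (\<And>t. t \<ge> a \<Longrightarrow> N (x t - y t) \<le> C * W t) \<Longrightarrow>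
        (\<And>t. t \<ge> a \<Longrightarrow> N (T x t - T y t) \<le> C * q * W t)"
    and x: "continuous_on {a..} x" "\<And>t. t \<ge> a \<Longrightarrow> x t = T x t"
    and y: "continuous_on {a..} y" "\<And>t. t \<ge> a \<Longrightarrow> y t = T y t"
    and C: "C \<ge> 0" "\<And>t. t \<ge> a \<Longrightarrow> N (x t - y t) \<le> C * W t"
    and t: "t \<ge> a"
  shows "x t = y t"
proof -
  have "N (x t - y t) \<le> C * q ^ n * W t" if "t \<ge> a" for t n
    using that
  proof (induction n arbitrary: t)
    case (Suc n)
    have "N (T x t - T y t) \<le> (C * q ^ n) * q * W t"
      using Suc C(1) q(1) by (intro contr x(1) y(1)) auto
    thus ?case using x(2)[OF Suc.prems] y(2)[OF Suc.prems] by (simp add: mult_ac)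
  qed (use C in auto)
  hence "N (x t - y t) \<le> (C * W t) * q ^ n" for n
    using t by (simp add: mult_ac)
  hence "N (x t - y t) = 0"
    by (intro geometric_bound_eq_zero[OF q] is_norm_nonneg N)
  thus ?thesis using N by (auto simp: is_norm_def)
qed

text \<open>Banach's argument for the Picard iterates of 0: increments shrink geometrically relative
  to \<open>W\<close>, and \<open>W\<close> is bounded on compact intervals, so the limit is locally
  uniform and hence continuous.\<close>

lemma weighted_contraction_exists:
  fixes N :: "'a::euclidean_space \<Rightarrow> real" and W :: "real \<Rightarrow> real"
  assumes N: "is_norm N" and q: "0 \<le> q" "q < 1"
    and W: "continuous_on {a..} W"
    and T: "\<And>x. continuous_on {a..} x \<Longrightarrow> continuous_on {a..} (T x)"
    and contr: "\<And>x y C. continuous_on {a..} x \<Longrightarrow> continuous_on {a..} y \<Longrightarrow> C \<ge> 0 \<Longrightarrow>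
        (\<And>t. t \<ge> a \<Longrightarrow> N (x t - y t) \<le> C * W t) \<Longrightarrow>
        (\<And>t. t \<ge> a \<Longrightarrow> N (T x t - T y t) \<le> C * q * W t)"
    and d: "d \<ge> 0" "\<And>t. t \<ge> a \<Longrightarrow> N (T (\<lambda>_. 0) t) \<le> d * W t"
  obtains x C where "continuous_on {a..} x" "C \<ge> 0" "\<And>t. t \<ge> a \<Longrightarrow> N (x t) \<le> C * W t"
    "\<And>t. t \<ge> a \<Longrightarrow> x t = T x t"
proof -
  define X where "X n = (T ^^ n) (\<lambda>_. 0)" for n
  have X_simps: "X 0 = (\<lambda>_. 0)" "X (Suc n) = T (X n)" for n
    by (auto simp: X_def)
  have X_cont: "continuous_on {a..} (X n)" for n
    by (induction n) (auto simp: X_simps intro: T)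
  have step: "N (X (Suc n) t - X n t) \<le> d * q ^ n * W t" if "t \<ge> a" for n t
    using that
  proof (induction n arbitrary: t)
    case (Suc n)
    have "N (T (X (Suc n)) t - T (X n) t) \<le> (d * q ^ n) * q * W t"
      using Suc d(1) q(1) by (intro contr X_cont) auto
    thus ?case by (simp add: X_simps mult_ac)
  qed (use d in \<open>auto simp: X_simps\<close>)
  have multi: "N (X (n + m) t - X n t) \<le> d / (1 - q) * q ^ n * W t" if t: "t \<ge> a" for n m t
  proof -
    \<comment> \<open>The sign comes from \<open>d(2)\<close>: the product bounds a value of
      \<open>N\<close>.\<close>
    have W0: "0 \<le> d * W t"
      using d(2)[OF t] is_norm_nonneg[OF N] order_trans by blast
    have "X (n + m) t - X n t = (\<Sum>i<m. X (Suc (n + i)) t - X (n + i) t)"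
      using sum_lessThan_telescope[of "\<lambda>i. X (n + i) t" m] by simp
    also have "N \<dots> \<le> (\<Sum>i<m. N (X (Suc (n + i)) t - X (n + i) t))"
      by (rule is_norm_sum_le[OF N])
    also have "\<dots> \<le> (\<Sum>i<m. d * q ^ (n + i) * W t)"
      by (intro sum_mono step t)
    also have "\<dots> = (d * W t * q ^ n) * (\<Sum>i<m. q ^ i)"
      by (simp add: sum_distrib_left power_add mult_ac)
    also have "\<dots> \<le> (d * W t * q ^ n) * (1 / (1 - q))"
    proof (intro mult_left_mono)
      show "(\<Sum>i<m. q ^ i) \<le> 1 / (1 - q)"
        using q by (simp add: sum_gp_strict divide_right_mono)
      show "0 \<le> d * W t * q ^ n" by (intro mult_nonneg_nonneg[OF W0]) (use q in auto)
    qed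
    finally show ?thesis by (simp add: mult_ac)
  qed
  \<comment> \<open>Uniform convergence refers to the metric of the type, so the estimates in
    \<open>N\<close> have to be carried over to \<open>norm\<close>.\<close>
  obtain B where B: "B > 0" "\<And>x. norm x \<le> B * N x"
    using norm_le_is_norm[OF N] by blast
  \<comment> \<open>Writing the limit as a telescoping series makes the Weierstrass test applicable;
    the partial sums are the iterates themselves because \<open>X 0\<close> is 0.\<close>
  define x where "x t = (\<Sum>i. X (Suc i) t - X i t)" for t
  have unif: "uniform_limit {a..b} X x sequentially" for b
  proof -
    have "bounded (W ` {a..b})"
      by (intro compact_imp_bounded compact_continuous_image continuous_on_subset[OF W]) auto
    then obtain K where K: "\<And>t. t \<in> {a..b} \<Longrightarrow> \<bar>W t\<bar> \<le> K"
      unfolding bounded_iff real_norm_def by blast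
    have "norm (X (Suc i) t - X i t) \<le> B * d * K * q ^ i" if "t \<in> {a..b}" for i t
    proof -
      have "norm (X (Suc i) t - X i t) \<le> B * N (X (Suc i) t - X i t)" by (rule B)
      also have "\<dots> \<le> B * (d * q ^ i * W t)"
        using B(1) that by (intro mult_left_mono step) auto
      also have "\<dots> \<le> B * (d * q ^ i * K)"
        using B(1) d(1) q K[OF that] by (intro mult_left_mono) auto
      finally show ?thesis by (simp add: mult_ac)
    qed
    hence "uniform_limit {a..b} (\<lambda>n t. \<Sum>i<n. X (Suc i) t - X i t) x sequentially"
      unfolding x_def using q
      by (intro Weierstrass_m_test[where M = "\<lambda>i. B * d * K * q ^ i"] summable_mult summable_geometric) auto
    moreover have "(\<Sum>i<n. X (Suc i) t - X i t) = X n t" for n t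
      using sum_lessThan_telescope[of "\<lambda>i. X i t" n] by (simp add: X_simps(1))
    ultimately show ?thesis by simp
  qed
  have x_cont: "continuous_on {a..} x"
    by (intro continuous_on_atLeast uniform_limit_theorem[OF _ unif] always_eventually allI
        continuous_on_subset[OF X_cont]) auto
  \<comment> \<open>Let m tend to infinity in \<open>multi\<close>.\<close>
  have close: "N (x t - X n t) \<le> d / (1 - q) * q ^ n * W t" if t: "t \<ge> a" for n t
  proof (rule LIMSEQ_le_const2)
    have "(\<lambda>m. X m t) \<longlonglongrightarrow> x t" using t by (intro tendsto_uniform_limitI[OF unif[of t]]) auto
    hence "(\<lambda>m. X (n + m) t) \<longlonglongrightarrow> x t" by (subst add.commute) (rule LIMSEQ_ignore_initial_segment)
    thus "(\<lambda>m. N (X (n + m) t - X n t)) \<longlonglongrightarrow> N (x t - X n t)"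
      by (intro continuous_on_tendsto_compose[OF is_norm_continuous_on[OF N, of UNIV]] tendsto_intros) auto
  qed (use multi[OF t] in auto)
  have C: "d / (1 - q) \<ge> 0" using d q by auto
  have fixed: "x t = T x t" if t: "t \<ge> a" for t
  proof -
    \<comment> \<open>Both \<open>x t\<close> and \<open>T x t\<close> are within \<open>E\<close>
      of \<open>X (Suc n) t\<close>: the first by \<open>close\<close> at \<open>Suc n\<close>, the
      second by contracting \<open>close\<close> at \<open>n\<close>.\<close>
    have "N (x t - T x t) \<le> (2 * (d / (1 - q)) * q * W t) * q ^ n" for n
    proof -
      define E where "E = d / (1 - q) * q ^ n * q * W t"
      have "N (T x t - T (X n) t) \<le> E"
        unfolding E_def
        by (intro contr X_cont x_cont close mult_nonneg_nonneg C zero_le_power q t)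
      moreover have "N (x t - X (Suc n) t) \<le> E"
        using close[OF t, of "Suc n"] by (simp add: E_def mult_ac)
      ultimately have "N (x t - T x t) \<le> 2 * E"
        using is_norm_diff_triangle[OF N, of "x t" "T x t" "X (Suc n) t"]
          is_norm_minus_commute[OF N, of "T x t" "X (Suc n) t"]
        by (simp add: X_simps)
      thus ?thesis by (simp add: E_def mult_ac)
    qed
    hence "N (x t - T x t) = 0"
      by (intro geometric_bound_eq_zero[OF q] is_norm_nonneg N)
    thus ?thesis using N by (auto simp: is_norm_def)
  qed
  show ?thesis
    \<comment> \<open>Since \<open>X 0\<close> is 0, \<open>close\<close> at index 0 is the weighted
      bound on \<open>x\<close>.\<close>
    using close[of _ 0] by (intro that[OF x_cont C _ fixed]) (auto simp: X_simps)
qed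

section \<open>The fractional integral with respect to a function\<close>

lemma beta_moment:
  fixes \<alpha> :: real
  assumes "\<alpha> > 0"
  shows "((\<lambda>v. (1 - v) powr (\<alpha> - 1) * (v powr \<alpha>) ^ k) has_integral Beta (\<alpha> * real k + 1) \<alpha>) {0..1}"
\<comment> \<open>At \<open>v = 0\<close> the integrands differ when \<open>k = 0\<close>: there
  \<open>(0 powr \<alpha>) ^ 0\<close> is 1 while \<open>0 powr 0\<close> is 0.\<close>
proof (rule has_integral_spike[of "{0}"])
  show "((\<lambda>v. v powr ((\<alpha> * real k + 1) - 1) * (1 - v) powr (\<alpha> - 1)) has_integral Beta (\<alpha> * real k + 1) \<alpha>) {0..1}"
    using assms by (intro has_integral_Beta_real) (auto intro: add_nonneg_pos)
qed (auto simp: powr_powr powr_realpow[symmetric])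

lemma absolutely_integrable_scaleR_continuous:
  fixes G :: "real \<Rightarrow> 'a::euclidean_space" and w :: "real \<Rightarrow> real"
  assumes "w absolutely_integrable_on {c..d}" "continuous_on {c..d} G"
  shows "(\<lambda>v. w v *\<^sub>R G v) absolutely_integrable_on {c..d}"
proof (rule absolutely_integrable_bounded_measurable_product[where h = "\<lambda>x y. y *\<^sub>R x"])
  show "bilinear (\<lambda>(x::'a) y. y *\<^sub>R x)"
    by (auto simp: bilinear_def linear_iff algebra_simps)
  show "bounded (G ` {c..d})"
    using assms(2) by (intro compact_imp_bounded compact_continuous_image) auto
qed (use assms in \<open>auto intro: continuous_imp_measurable_on_sets_lebesgue\<close>)

text \<open>Sequential continuity by dominated convergence. The majorant is
  \<open>\<bar>w v\<bar> * B\<close> with \<open>B\<close> a bound for \<open>F\<close> on the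
  compact product, so \<open>w\<close> may be singular as long as it is absolutely
  integrable.\<close>

lemma continuous_on_weighted_integral:
  fixes F :: "'b::metric_space \<Rightarrow> real \<Rightarrow> 'a::euclidean_space" and w :: "real \<Rightarrow> real"
  assumes w: "w absolutely_integrable_on {c..d}" and K: "compact K"
    and F: "continuous_on (K \<times> {c..d}) (\<lambda>(t, v). F t v)"
  shows "continuous_on K (\<lambda>t. integral {c..d} (\<lambda>v. w v *\<^sub>R F t v))"
proof -
  have "bounded ((\<lambda>(t, v). F t v) ` (K \<times> {c..d}))"
    by (intro compact_imp_bounded compact_continuous_image F compact_Times K) auto
  then obtain B where B: "\<And>t v. t \<in> K \<Longrightarrow> v \<in> {c..d} \<Longrightarrow> norm (F t v) \<le> B"
    by (force simp: bounded_iff)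
  have cont: "continuous_on {c..d} (F t)" if "t \<in> K" for t
    using that by (intro continuous_on_compose2[OF F, of _ "\<lambda>v. (t, v)", simplified] continuous_intros) auto
  show ?thesis
    unfolding continuous_on_sequentially o_def
  proof (intro allI ballI impI)
    fix X t assume t: "t \<in> K" and X: "(\<forall>n. X n \<in> K) \<and> X \<longlonglongrightarrow> t"
    show "(\<lambda>n. integral {c..d} (\<lambda>v. w v *\<^sub>R F (X n) v)) \<longlonglongrightarrow> integral {c..d} (\<lambda>v. w v *\<^sub>R F t v)"
    proof (rule dominated_convergence)
      show "(\<lambda>v. w v *\<^sub>R F (X n) v) integrable_on {c..d}" for n
        using X by (intro set_lebesgue_integral_eq_integral absolutely_integrable_scaleR_continuous w cont) auto
      show "(\<lambda>v. \<bar>w v\<bar> * B) integrable_on {c..d}"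
        using w by (intro integrable_on_mult_left) (auto simp: absolutely_integrable_on_def)
      show "norm (w v *\<^sub>R F (X n) v) \<le> \<bar>w v\<bar> * B" if "v \<in> {c..d}" for n v
        using B[of "X n" v] that X by (auto intro: mult_left_mono)
      show "(\<lambda>n. w v *\<^sub>R F (X n) v) \<longlonglongrightarrow> w v *\<^sub>R F t v" if v: "v \<in> {c..d}" for v
      proof (intro tendsto_intros)
        have "(\<lambda>n. (X n, v)) \<longlonglongrightarrow> (t, v)" using X by (intro tendsto_intros) auto
        from continuous_on_tendsto_compose[OF F this] show "(\<lambda>n. F (X n) v) \<longlonglongrightarrow> F t v"
          using t v X by auto
      qed
    qed
  qed
qed

text \<open>Positivity of \<open>\<psi>'\<close> is the form in which monotonicity of \<psi> and
  non-vanishing of \<open>\<psi>'\<close> are used: it makes \<psi> injective on the half-line and a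
  legitimate substitution.\<close>

locale psi_function =
  fixes a \<alpha> :: real and \<psi> \<psi>' :: "real \<Rightarrow> real"
  assumes alpha_pos: "\<alpha> > 0"
    and deriv: "\<And>t. t \<ge> a \<Longrightarrow> (\<psi> has_real_derivative \<psi>' t) (at t within {a..})"
    and deriv_pos: "\<And>t. t \<ge> a \<Longrightarrow> \<psi>' t > 0"
begin

section \<open>Strict monotonicity and inversion of the substitution\<close>

lemma psi_continuous_on: "continuous_on {a..} \<psi>"
  using deriv by (auto intro!: DERIV_continuous_on)

lemma psi_less:
  assumes "a \<le> s" "s < t"
  shows "\<psi> s < \<psi> t"
proof -
  have "\<exists>x\<in>{s<..<t}. \<psi> t - \<psi> s = \<psi>' x * (t - s)"
    using assms(1)
    by (intro mvt_simple assms(2))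
       (auto simp: has_field_derivative_def[symmetric] intro!: DERIV_subset[OF deriv])
  then obtain x where "x \<in> {s<..<t}" "\<psi> t - \<psi> s = \<psi>' x * (t - s)" ..
  moreover have "\<psi>' x * (t - s) > 0"
    using assms deriv_pos[of x] calculation(1) by auto
  ultimately show ?thesis by linarith
qed

lemma psi_mono: "a \<le> s \<Longrightarrow> s \<le> t \<Longrightarrow> \<psi> s \<le> \<psi> t"
  using psi_less[of s t] by (cases "s = t") auto

lemma psi_inj_on: "inj_on \<psi> {a..}"
  by (rule linorder_inj_onI) (auto dest: psi_less)

text \<open>The inverse of the substitution \<open>s \<mapsto> (\<psi> s - \<psi> a) / (\<psi> t - \<psi> a)\<close>.\<close>

definition point :: "real \<Rightarrow> real \<Rightarrow> real" where
  "point t v = inv_into {a..} \<psi> (\<psi> a + v * (\<psi> t - \<psi> a))"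

lemma point_value_in_image:
  assumes "t \<ge> a" "v \<in> {0..1}"
  shows "\<psi> a + v * (\<psi> t - \<psi> a) \<in> \<psi> ` {a..t}"
proof -
  have "v * (\<psi> t - \<psi> a) \<le> 1 * (\<psi> t - \<psi> a)" "0 \<le> v * (\<psi> t - \<psi> a)"
    using assms psi_mono[of a t] by (intro mult_right_mono mult_nonneg_nonneg; simp)+
  moreover have "continuous_on {a..t} \<psi>"
    by (rule continuous_on_subset[OF psi_continuous_on]) auto
  ultimately have "\<exists>x\<ge>a. x \<le> t \<and> \<psi> x = \<psi> a + v * (\<psi> t - \<psi> a)"
    using assms(1) by (intro IVT') auto
  then obtain x where "a \<le> x" "x \<le> t" "\<psi> x = \<psi> a + v * (\<psi> t - \<psi> a)" by blast
  thus ?thesis by (metis atLeastAtMost_iff imageI)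
qed

lemma
  assumes "t \<ge> a" "v \<in> {0..1}"
  shows point_in: "point t v \<in> {a..t}"
    and psi_point: "\<psi> (point t v) = \<psi> a + v * (\<psi> t - \<psi> a)"
proof -
  obtain s where s: "s \<in> {a..t}" "\<psi> a + v * (\<psi> t - \<psi> a) = \<psi> s"
    using point_value_in_image[OF assms] by auto
  hence "point t v = s"
    unfolding point_def by (simp add: psi_inj_on inv_into_f_f)
  with s show "point t v \<in> {a..t}" "\<psi> (point t v) = \<psi> a + v * (\<psi> t - \<psi> a)" by auto
qed

lemma point_ratio:
  assumes "a < t" "s \<in> {a..t}"
  shows "point t ((\<psi> s - \<psi> a) / (\<psi> t - \<psi> a)) = s"
  unfolding point_def using assms psi_less[of a t] by (simp add: psi_inj_on inv_into_f_f)

text \<open>A continuous injection on the compact interval \<open>{a..T}\<close> has a continuous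
  inverse, here composed with a jointly continuous map. Joint continuity is what the integral with
  parameter \<open>t\<close> requires.\<close>

lemma point_continuous_on: "continuous_on ({a..T} \<times> {0..1}) (\<lambda>(t, v). point t v)"
proof -
  have inv: "continuous_on (\<psi> ` {a..T}) (inv_into {a..} \<psi>)"
    by (rule continuous_on_inv)
       (auto simp: psi_inj_on inv_into_f_f intro: continuous_on_subset[OF psi_continuous_on])
  have sub: "\<psi> a + v * (\<psi> t - \<psi> a) \<in> \<psi> ` {a..T}" if "t \<in> {a..T}" "v \<in> {0..1}" for t v
    using point_value_in_image[of t v] that by auto
  have fst: "continuous_on ({a..T} \<times> {0..1::real}) (\<lambda>p. \<psi> (fst p))"
    by (rule continuous_on_compose2[OF psi_continuous_on]) (auto intro: continuous_intros)
  show ?thesis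
    unfolding point_def case_prod_unfold
    by (rule continuous_on_compose2[OF inv]) (use sub in \<open>auto intro!: continuous_intros fst\<close>)
qed

section \<open>Change of variables to the unit interval\<close>

lemma weight_absolutely_integrable: "(\<lambda>v. (1 - v) powr (\<alpha> - 1)) absolutely_integrable_on {0..1}"
  using has_integral_integrable[OF beta_moment[OF alpha_pos, of 0]]
  by (intro nonnegative_absolutely_integrable_1) auto

lemma
  fixes g :: "real \<Rightarrow> 'a::euclidean_space"
  assumes t: "t \<ge> a" and g: "continuous_on {a..t} g"
  shows kernel_absolutely_integrable:
      "(\<lambda>s. psi_kernel \<psi> \<psi>' \<alpha> t s *\<^sub>R g s) absolutely_integrable_on {a..t}" (is ?int)
    and kernel_integral_eq:
      "integral {a..t} (\<lambda>s. psi_kernel \<psi> \<psi>' \<alpha> t s *\<^sub>R g s) =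
        (\<psi> t - \<psi> a) powr \<alpha> *\<^sub>R integral {0..1} (\<lambda>v. (1 - v) powr (\<alpha> - 1) *\<^sub>R g (point t v))" (is ?eq)
proof -
  have "?int \<and> ?eq"
  proof (cases "t = a")
    \<comment> \<open>The interval degenerates to a point, and the right-hand side vanishes because
      \<open>0 powr \<alpha>\<close> is 0.\<close>
    case True
    thus ?thesis
      by (auto simp: absolutely_integrable_on_def integrable_on_refl[where 'a=real, simplified])
  next
    case False
    hence at: "a < t" using t by simp
    define D where "D = \<psi> t - \<psi> a"
    define u where "u s = (\<psi> s - \<psi> a) / D" for s
    \<comment> \<open>The power of \<open>D\<close> collects \<open>D powr (\<alpha> - 1)\<close>
      from the kernel and one factor \<open>D\<close> from the substitution.\<close>
    define h where "h v = D powr \<alpha> *\<^sub>R ((1 - v) powr (\<alpha> - 1) *\<^sub>R g (point t v))" for v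
    have D: "D > 0" using psi_less[OF _ at] by (simp add: D_def)
    have img: "u ` {a..t} = {0..1}"
    proof (intro equalityI subsetI)
      fix v assume "v \<in> u ` {a..t}"
      thus "v \<in> {0..1}" using D psi_mono by (auto simp: u_def D_def)
    next
      fix v :: real assume "v \<in> {0..1}"
      hence "point t v \<in> {a..t}" "v = u (point t v)"
        using point_in[OF t] psi_point[OF t] D by (auto simp: u_def D_def)
      thus "v \<in> u ` {a..t}" by blast
    qed
    have "continuous_on {0..1} (point t)"
      using t by (intro continuous_on_compose2[OF point_continuous_on[of t], of _ "\<lambda>v. (t, v)", simplified] continuous_intros) auto
    hence "continuous_on {0..1} (\<lambda>v. g (point t v))"
      by (rule continuous_on_compose2[OF g]) (use point_in[OF t] in auto)
    hence h: "h absolutely_integrable_on {0..1}"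
      unfolding h_def
      by (intro absolutely_integrable_scaleR_left absolutely_integrable_scaleR_continuous weight_absolutely_integrable)
    \<comment> \<open>The right-hand side of this equivalence is known from \<open>h\<close> and
      \<open>img\<close>; the left-hand side then gives integrability and value together.\<close>
    have "(\<lambda>s. \<bar>\<psi>' s / D\<bar> *\<^sub>R h (u s)) absolutely_integrable_on {a..t} \<and>
          integral {a..t} (\<lambda>s. \<bar>\<psi>' s / D\<bar> *\<^sub>R h (u s)) = integral {0..1} h
        \<longleftrightarrow> h absolutely_integrable_on u ` {a..t} \<and> integral (u ` {a..t}) h = integral {0..1} h"
    proof (rule has_absolute_integral_change_of_variables_real)
      fix s assume "s \<in> {a..t}"
      hence "(\<psi> has_real_derivative \<psi>' s) (at s within {a..t})"
        by (intro DERIV_subset[OF deriv]) auto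
      thus "(u has_real_derivative \<psi>' s / D) (at s within {a..t})"
        unfolding u_def using D by (auto intro!: derivative_eq_intros)
    next
      show "inj_on u {a..t}"
        using inj_on_subset[OF psi_inj_on, of "{a..t}"] D by (auto simp: u_def inj_on_def)
    qed auto
    moreover have eq: "\<bar>\<psi>' s / D\<bar> *\<^sub>R h (u s) = psi_kernel \<psi> \<psi>' \<alpha> t s *\<^sub>R g s" if s: "s \<in> {a..t}" for s
    proof -
      have pt: "point t (u s) = s"
        unfolding u_def D_def by (rule point_ratio[OF at s])
      have 1: "1 - u s = (\<psi> t - \<psi> s) / D" using D by (simp add: u_def D_def field_simps)
      \<comment> \<open>This includes \<open>s = t\<close>, where both sides are 0 by the convention
        for \<open>0 powr\<close>.\<close>
      have "(\<psi>' s / D) * D powr \<alpha> * (1 - u s) powr (\<alpha> - 1) = psi_kernel \<psi> \<psi>' \<alpha> t s"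
        unfolding 1 psi_kernel_def using D psi_mono[of s t] s
        by (simp add: powr_divide powr_diff)
      thus ?thesis using deriv_pos[of s] s D by (simp add: h_def pt)
    qed
    moreover have "(\<lambda>s. \<bar>\<psi>' s / D\<bar> *\<^sub>R h (u s)) absolutely_integrable_on {a..t} \<longleftrightarrow> ?int"
      by (rule set_integrable_cong[OF refl refl eq])
    moreover have "integral {a..t} (\<lambda>s. \<bar>\<psi>' s / D\<bar> *\<^sub>R h (u s)) =
        integral {a..t} (\<lambda>s. psi_kernel \<psi> \<psi>' \<alpha> t s *\<^sub>R g s)"
      by (rule integral_cong[OF eq])
    moreover have "integral {0..1} h =
        D powr \<alpha> *\<^sub>R integral {0..1} (\<lambda>v. (1 - v) powr (\<alpha> - 1) *\<^sub>R g (point t v))"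
      unfolding h_def by (rule integral_cmul)
    ultimately show ?thesis using h img by (simp add: D_def)
  qed
  thus ?int ?eq by auto
qed

lemmas kernel_integrable =
  set_lebesgue_integral_eq_integral(1)[OF kernel_absolutely_integrable]

section \<open>Linearity, monotonicity and norm bound of the fractional integral\<close>

lemma psi_integral_diff:
  fixes g h :: "real \<Rightarrow> 'a::euclidean_space"
  assumes "t \<ge> a" "continuous_on {a..t} g" "continuous_on {a..t} h"
  shows "psi_integral a \<psi> \<psi>' \<alpha> t g - psi_integral a \<psi> \<psi>' \<alpha> t h = psi_integral a \<psi> \<psi>' \<alpha> t (\<lambda>s. g s - h s)"
  using assms unfolding psi_integral_def
  by (simp add: scaleR_diff_right integral_diff kernel_integrable)

lemma psi_integral_cmult:
  "psi_integral a \<psi> \<psi>' \<alpha> t (\<lambda>s. c * g s :: real) = c * psi_integral a \<psi> \<psi>' \<alpha> t g"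
  unfolding psi_integral_def by (simp add: mult.left_commute[of _ c])

lemma psi_integral_sum:
  fixes g :: "'b \<Rightarrow> real \<Rightarrow> 'a::euclidean_space"
  assumes "t \<ge> a" "finite A" "\<And>k. k \<in> A \<Longrightarrow> continuous_on {a..t} (g k)"
  shows "psi_integral a \<psi> \<psi>' \<alpha> t (\<lambda>s. \<Sum>k\<in>A. g k s) = (\<Sum>k\<in>A. psi_integral a \<psi> \<psi>' \<alpha> t (g k))"
  using assms unfolding psi_integral_def
  by (simp add: scaleR_sum_right integral_sum kernel_integrable)

lemma psi_kernel_nonneg: "s \<ge> a \<Longrightarrow> psi_kernel \<psi> \<psi>' \<alpha> t s \<ge> 0"
  using deriv_pos[of s] by (simp add: psi_kernel_def)

lemma psi_integral_mono:
  fixes g h :: "real \<Rightarrow> real"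
  assumes "t \<ge> a" "continuous_on {a..t} g" "continuous_on {a..t} h" "\<And>s. s \<in> {a..t} \<Longrightarrow> g s \<le> h s"
  shows "psi_integral a \<psi> \<psi>' \<alpha> t g \<le> psi_integral a \<psi> \<psi>' \<alpha> t h"
  unfolding psi_integral_def using assms alpha_pos
  by (intro scaleR_left_mono integral_le kernel_integrable) (auto intro!: mult_left_mono psi_kernel_nonneg)

lemma is_norm_psi_integral_le:
  fixes g :: "real \<Rightarrow> 'a::euclidean_space"
  assumes N: "is_norm N" and t: "t \<ge> a" and g: "continuous_on {a..t} g"
  shows "N (psi_integral a \<psi> \<psi>' \<alpha> t g) \<le> psi_integral a \<psi> \<psi>' \<alpha> t (\<lambda>s. N (g s))"
proof -
  have scale: "N (c *\<^sub>R x) = \<bar>c\<bar> * N x" for c x using N by (auto simp: is_norm_def)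
  \<comment> \<open>The kernel is nonnegative, so homogeneity pulls it out of \<open>N\<close>
    without an absolute value.\<close>
  have eq: "N (psi_kernel \<psi> \<psi>' \<alpha> t s *\<^sub>R g s) = psi_kernel \<psi> \<psi>' \<alpha> t s *\<^sub>R N (g s)" if "s \<in> {a..t}" for s
    using psi_kernel_nonneg[of s t] that by (simp add: scale)
  have "continuous_on {a..t} (\<lambda>s. N (g s))"
    by (rule continuous_on_compose2[OF is_norm_continuous_on[OF N] g]) auto
  from kernel_integrable[OF t this]
  have int: "(\<lambda>s. N (psi_kernel \<psi> \<psi>' \<alpha> t s *\<^sub>R g s)) integrable_on {a..t}"
    by (rule integrable_eq) (simp add: eq)
  have "integral {a..t} (\<lambda>s. N (psi_kernel \<psi> \<psi>' \<alpha> t s *\<^sub>R g s)) =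
      integral {a..t} (\<lambda>s. psi_kernel \<psi> \<psi>' \<alpha> t s *\<^sub>R N (g s))"
    by (rule integral_cong) (rule eq)
  hence "N (integral {a..t} (\<lambda>s. psi_kernel \<psi> \<psi>' \<alpha> t s *\<^sub>R g s))
      \<le> integral {a..t} (\<lambda>s. psi_kernel \<psi> \<psi>' \<alpha> t s *\<^sub>R N (g s))"
    using is_norm_integral_le[OF N kernel_integrable[OF t g] int] by simp
  thus ?thesis
    unfolding psi_integral_def scale using alpha_pos by (simp add: divide_right_mono)
qed

section \<open>Continuity in the upper limit\<close>

lemma power_continuous_on: "continuous_on {a..} (\<lambda>t. (\<psi> t - \<psi> a) powr \<alpha>)"
  using alpha_pos psi_mono[of a]
  \<comment> \<open>The base vanishes at \<open>a\<close>; continuity there rests on the positive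
    exponent.\<close>
  by (intro continuous_on_powr' continuous_intros psi_continuous_on) auto

text \<open>Interval and kernel both vary with \<open>t\<close>. After the substitution they are
  fixed, and \<open>t\<close> enters only through the prefactor and a jointly continuous
  integrand.\<close>

lemma psi_integral_continuous_on:
  fixes g :: "real \<Rightarrow> real \<Rightarrow> 'a::euclidean_space"
  assumes g: "continuous_on {(t, s). a \<le> s \<and> s \<le> t} (\<lambda>(t, s). g t s)"
  shows "continuous_on {a..} (\<lambda>t. psi_integral a \<psi> \<psi>' \<alpha> t (g t))"
proof (rule continuous_on_atLeast)
  fix T assume "T \<ge> a"
  have eq: "psi_integral a \<psi> \<psi>' \<alpha> t (g t) = (1 / Gamma \<alpha>) *\<^sub>R ((\<psi> t - \<psi> a) powr \<alpha> *\<^sub>R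
      integral {0..1} (\<lambda>v. (1 - v) powr (\<alpha> - 1) *\<^sub>R g t (point t v)))" if "t \<in> {a..T}" for t
  proof -
    have "continuous_on {a..t} (g t)"
      by (rule continuous_on_compose2[OF g, of _ "\<lambda>s. (t, s)", simplified]) (auto intro: continuous_intros)
    thus ?thesis using that by (simp add: psi_integral_def kernel_integral_eq)
  qed
  have pc: "continuous_on ({a..T} \<times> {0..1}) (\<lambda>p. point (fst p) (snd p))"
    using point_continuous_on[of T] by (simp add: case_prod_unfold)
  have "continuous_on ({a..T} \<times> {0..1}) (\<lambda>(t, v). g t (point t v))"
    unfolding case_prod_unfold
    by (rule continuous_on_compose2[OF g, of _ "\<lambda>p. (fst p, point (fst p) (snd p))", simplified])
       (use point_in in \<open>auto intro!: continuous_intros pc\<close>)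
  hence "continuous_on {a..T} (\<lambda>t. integral {0..1} (\<lambda>v. (1 - v) powr (\<alpha> - 1) *\<^sub>R g t (point t v)))"
    by (intro continuous_on_weighted_integral weight_absolutely_integrable) auto
  moreover have "continuous_on {a..T} (\<lambda>t. (\<psi> t - \<psi> a) powr \<alpha>)"
    by (rule continuous_on_subset[OF power_continuous_on]) auto
  ultimately have "continuous_on {a..T} (\<lambda>t. (1 / Gamma \<alpha>) *\<^sub>R ((\<psi> t - \<psi> a) powr \<alpha> *\<^sub>R
      integral {0..1} (\<lambda>v. (1 - v) powr (\<alpha> - 1) *\<^sub>R g t (point t v))))"
    by (intro continuous_on_scaleR continuous_on_const)
  thus "continuous_on {a..T} (\<lambda>t. psi_integral a \<psi> \<psi>' \<alpha> t (g t))"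
    using eq by (subst continuous_on_cong[OF refl]) auto
qed

section \<open>The fractional integral of the Mittag-Leffler weight\<close>

lemma psi_integral_power:
  assumes t: "t \<ge> a"
  shows "psi_integral a \<psi> \<psi>' \<alpha> t (\<lambda>s. ((\<psi> s - \<psi> a) powr \<alpha>) ^ k) =
    Gamma (\<alpha> * real k + 1) / Gamma (\<alpha> * real (Suc k) + 1) * ((\<psi> t - \<psi> a) powr \<alpha>) ^ Suc k"
proof -
  define D where "D = \<psi> t - \<psi> a"
  have D: "D \<ge> 0" using psi_mono[of a t] t by (simp add: D_def)
  have "continuous_on {a..t} (\<lambda>s. ((\<psi> s - \<psi> a) powr \<alpha>) ^ k)"
    by (intro continuous_intros continuous_on_subset[OF power_continuous_on]) auto
  hence "psi_integral a \<psi> \<psi>' \<alpha> t (\<lambda>s. ((\<psi> s - \<psi> a) powr \<alpha>) ^ k) = D powr \<alpha> *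
      integral {0..1} (\<lambda>v. (1 - v) powr (\<alpha> - 1) * ((\<psi> (point t v) - \<psi> a) powr \<alpha>) ^ k) / Gamma \<alpha>"
    using kernel_integral_eq[OF t, of "\<lambda>s. ((\<psi> s - \<psi> a) powr \<alpha>) ^ k"]
    by (simp add: psi_integral_def D_def)
  \<comment> \<open>At \<open>point t v\<close> the increment of \<psi> is \<open>v * D\<close>, so
    a power of \<open>D\<close> splits off and a Beta moment remains.\<close>
  also have "integral {0..1} (\<lambda>v. (1 - v) powr (\<alpha> - 1) * ((\<psi> (point t v) - \<psi> a) powr \<alpha>) ^ k) =
      integral {0..1} (\<lambda>v. (D powr \<alpha>) ^ k * ((1 - v) powr (\<alpha> - 1) * (v powr \<alpha>) ^ k))"
    using D by (intro integral_cong) (simp add: psi_point[OF t] D_def[symmetric] powr_mult power_mult_distrib)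
  also have "\<dots> = (D powr \<alpha>) ^ k * Beta (\<alpha> * real k + 1) \<alpha>"
    using integral_unique[OF beta_moment[OF alpha_pos, of k]] by simp
  also have "Beta (\<alpha> * real k + 1) \<alpha> = Gamma (\<alpha> * real k + 1) * Gamma \<alpha> / Gamma (\<alpha> * real (Suc k) + 1)"
    by (simp add: Beta_def algebra_simps)
  finally show ?thesis using Gamma_real_pos[OF alpha_pos] by (simp add: D_def)
qed

lemma ml_weight_continuous_on:
  assumes "\<alpha> \<le> 1"
  shows "continuous_on {a..} (ml_weight a \<psi> \<alpha> \<xi>)"
  unfolding ml_weight_def[abs_def]
  by (rule continuous_on_compose2[OF mittag_leffler_continuous_on[OF alpha_pos assms, of UNIV]])
     (auto intro!: continuous_intros power_continuous_on)

text \<open>Fractional integration sends the k-th term of the series to the next one, divided by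
  \<xi>. A partial sum thus integrates to a finite subsum of the series over \<xi>, and dominated
  convergence passes the bound to \<open>W\<close>.\<close>

lemma psi_integral_ml_weight_le:
  assumes t: "t \<ge> a" and \<alpha>: "\<alpha> \<le> 1" and \<xi>: "\<xi> > 0"
  shows "psi_integral a \<psi> \<psi>' \<alpha> t (ml_weight a \<psi> \<alpha> \<xi>) \<le> ml_weight a \<psi> \<alpha> \<xi> t / \<xi>"
proof -
  define z where "z s = \<xi> * (\<psi> s - \<psi> a) powr \<alpha>" for s
  define S where "S n s = (\<Sum>k<n. z s ^ k / Gamma (\<alpha> * real k + 1))" for n s
  let ?W = "ml_weight a \<psi> \<alpha> \<xi>"
  have z0: "z s \<ge> 0" for s using \<xi> by (simp add: z_def)
  have W: "?W s = mittag_leffler \<alpha> (z s)" for s by (simp add: ml_weight_def z_def)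
  have S_le: "S n s \<le> ?W s" for n s
    unfolding S_def W by (intro mittag_leffler_partial_le alpha_pos \<alpha> z0) auto
  have S_nn: "S n s \<ge> 0" for n s
    unfolding S_def using z0 alpha_pos by (intro sum_nonneg divide_nonneg_pos Gamma_real_pos) (auto intro: add_nonneg_pos)
  have zc: "continuous_on {a..t} z"
    unfolding z_def by (intro continuous_intros continuous_on_subset[OF power_continuous_on]) auto
  have Gne: "Gamma (\<alpha> * real k + 1) \<noteq> 0" for k
    using alpha_pos by (intro less_imp_neq[symmetric] Gamma_real_pos add_nonneg_pos) auto
  have Sc: "continuous_on {a..t} (S n)" for n
    unfolding S_def by (intro continuous_intros zc ballI Gne)
  have Wc: "continuous_on {a..t} ?W"
    by (rule continuous_on_subset[OF ml_weight_continuous_on[OF \<alpha>]]) auto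
  have S_lim: "(\<lambda>n. S n s) \<longlonglongrightarrow> ?W s" for s
    unfolding S_def W mittag_leffler_def
    by (intro summable_LIMSEQ mittag_leffler_summable alpha_pos \<alpha>)
  have powc: "continuous_on {a..t} (\<lambda>s. ((\<psi> s - \<psi> a) powr \<alpha>) ^ k)" for k
    by (intro continuous_intros continuous_on_subset[OF power_continuous_on]) auto
  have bound: "psi_integral a \<psi> \<psi>' \<alpha> t (S n) \<le> ?W t / \<xi>" for n
  proof -
    have S_eq: "S n = (\<lambda>s. \<Sum>k<n. (\<xi> ^ k / Gamma (\<alpha> * real k + 1)) * ((\<psi> s - \<psi> a) powr \<alpha>) ^ k)"
      by (simp add: fun_eq_iff S_def z_def power_mult_distrib)
    have "psi_integral a \<psi> \<psi>' \<alpha> t (S n) = (\<Sum>k<n. psi_integral a \<psi> \<psi>' \<alpha> t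
        (\<lambda>s. (\<xi> ^ k / Gamma (\<alpha> * real k + 1)) * ((\<psi> s - \<psi> a) powr \<alpha>) ^ k))"
      unfolding S_eq by (rule psi_integral_sum[OF t finite_lessThan]) (rule continuous_on_mult_left[OF powc])
    also have "\<dots> = (\<Sum>k<n. z t ^ Suc k / Gamma (\<alpha> * real (Suc k) + 1) / \<xi>)"
    proof (rule sum.cong[OF refl])
      fix k
      have "psi_integral a \<psi> \<psi>' \<alpha> t
          (\<lambda>s. (\<xi> ^ k / Gamma (\<alpha> * real k + 1)) * ((\<psi> s - \<psi> a) powr \<alpha>) ^ k) =
        \<xi> ^ k / Gamma (\<alpha> * real k + 1) *
          (Gamma (\<alpha> * real k + 1) / Gamma (\<alpha> * real (Suc k) + 1) * ((\<psi> t - \<psi> a) powr \<alpha>) ^ Suc k)"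
        by (subst psi_integral_cmult) (simp only: psi_integral_power[OF t])
      also have "\<dots> = \<xi> ^ k * ((\<psi> t - \<psi> a) powr \<alpha>) ^ Suc k / Gamma (\<alpha> * real (Suc k) + 1)"
        using Gne[of k] by (simp del: of_nat_Suc power_Suc)
      also have "\<dots> = z t ^ Suc k / Gamma (\<alpha> * real (Suc k) + 1) / \<xi>"
        using \<xi> by (simp add: z_def power_mult_distrib)
      finally show "psi_integral a \<psi> \<psi>' \<alpha> t
          (\<lambda>s. (\<xi> ^ k / Gamma (\<alpha> * real k + 1)) * ((\<psi> s - \<psi> a) powr \<alpha>) ^ k) =
        z t ^ Suc k / Gamma (\<alpha> * real (Suc k) + 1) / \<xi>" .
    qed
    \<comment> \<open>The shifted sum runs over the indices 1 to n; nonnegativity of the terms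
      bounds it by the whole series.\<close>
    also have "\<dots> = (\<Sum>k\<in>Suc ` {..<n}. z t ^ k / Gamma (\<alpha> * real k + 1)) / \<xi>"
      by (simp add: sum.reindex sum_divide_distrib)
    also have "\<dots> \<le> ?W t / \<xi>"
      unfolding W using \<xi> z0 by (intro divide_right_mono mittag_leffler_partial_le alpha_pos \<alpha>) auto
    finally show ?thesis .
  qed
  have "(\<lambda>n. integral {a..t} (\<lambda>s. psi_kernel \<psi> \<psi>' \<alpha> t s *\<^sub>R S n s))
      \<longlonglongrightarrow> integral {a..t} (\<lambda>s. psi_kernel \<psi> \<psi>' \<alpha> t s *\<^sub>R ?W s)"
  \<comment> \<open>The partial sums lie between 0 and the weight, so the kernel times the weight is
    a majorant.\<close>
  proof (rule dominated_convergence)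
    show "(\<lambda>s. psi_kernel \<psi> \<psi>' \<alpha> t s *\<^sub>R ?W s) integrable_on {a..t}"
      by (rule kernel_integrable[OF t Wc])
    show "(\<lambda>s. psi_kernel \<psi> \<psi>' \<alpha> t s *\<^sub>R S n s) integrable_on {a..t}" for n
      by (rule kernel_integrable[OF t Sc])
    show "norm (psi_kernel \<psi> \<psi>' \<alpha> t s *\<^sub>R S n s) \<le> psi_kernel \<psi> \<psi>' \<alpha> t s *\<^sub>R ?W s" if "s \<in> {a..t}" for n s
      using psi_kernel_nonneg[of s t] S_le[of n s] S_nn[of n s] that
      by (auto simp: abs_mult intro: mult_left_mono)
    show "(\<lambda>n. psi_kernel \<psi> \<psi>' \<alpha> t s *\<^sub>R S n s) \<longlonglongrightarrow> psi_kernel \<psi> \<psi>' \<alpha> t s *\<^sub>R ?W s" for s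
      by (intro tendsto_intros S_lim)
  qed
  hence "(\<lambda>n. psi_integral a \<psi> \<psi>' \<alpha> t (S n)) \<longlonglongrightarrow> psi_integral a \<psi> \<psi>' \<alpha> t ?W"
    unfolding psi_integral_def by (intro tendsto_intros)
  thus ?thesis by (rule LIMSEQ_le_const2) (use bound in auto)
qed

end

section \<open>The integral equation\<close>

theorem theorem3:
  fixes a \<alpha> L \<xi> M \<delta> :: real
    and \<psi> \<psi>' :: "real \<Rightarrow> real"
    and N :: "real ^ 'n \<Rightarrow> real"
    and f :: "real \<Rightarrow> real ^ 'n \<Rightarrow> real ^ 'n \<Rightarrow> real ^ 'n"
    and k :: "real \<Rightarrow> real \<Rightarrow> real ^ 'n \<Rightarrow> real ^ 'n"
  assumes alpha: "0 < \<alpha>" "\<alpha> \<le> 1"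
    and norm: "is_norm N"
    and psi_incr: "mono_on {a..} \<psi>"
    and psi_pos: "\<And>t. t > a \<Longrightarrow> \<psi> t > 0"
    and psi_deriv: "\<And>t. t \<ge> a \<Longrightarrow> (\<psi> has_real_derivative \<psi>' t) (at t within {a..})"
    and psi'_cont: "continuous_on {a..} \<psi>'"
    and psi'_nz: "\<And>t. t \<ge> a \<Longrightarrow> \<psi>' t \<noteq> 0"
    and params: "L > 0" "\<xi> > 0" "M \<ge> 0" "\<delta> > 1" "\<xi> = L * \<delta>"
    and f_cont: "continuous_on ({a..} \<times> UNIV \<times> UNIV) (\<lambda>(t, u, v). f t u v)"
    and k_cont: "continuous_on {(t, s, u). a \<le> s \<and> s \<le> t} (\<lambda>(t, s, u). k t s u)"
    and f_lip: "\<And>t u v u' v'. t \<ge> a \<Longrightarrow>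
          N (f t u v - f t u' v') \<le> M * (N (u - u') + N (v - v'))"
    and k_lip: "\<And>t s u u'. a \<le> s \<Longrightarrow> s \<le> t \<Longrightarrow>
          N (k t s u - k t s u') \<le> L * N (u - u')"
    and d1_finite: "bdd_above ((\<lambda>t. 1 / ml_weight a \<psi> \<alpha> \<xi> t *
          N (f t 0 (psi_integral a \<psi> \<psi>' \<alpha> t (\<lambda>s. k t s 0)))) ` {a..})"
    and contr: "M * (1 + 1 / \<delta>) < 1"
  shows "\<exists>!x. x \<in> C_space N a \<psi> \<alpha> \<xi> \<and>
          (\<forall>t\<ge>a. x t = f t (x t) (psi_integral a \<psi> \<psi>' \<alpha> t (\<lambda>s. k t s (x s))))"
proof -
  \<comment> \<open>Difference quotients of an increasing function are nonnegative, hence so is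
    their limit, and it is nonzero by hypothesis.\<close>
  have "\<psi>' t > 0" if t: "t \<ge> a" for t
  proof -
    have "((\<lambda>y. (\<psi> y - \<psi> t) / (y - t)) \<longlongrightarrow> \<psi>' t) (at t within {a..})"
      using psi_deriv[OF t] by (simp add: has_field_derivative_iff)
    moreover have "\<forall>\<^sub>F y in at t within {a..}. 0 \<le> (\<psi> y - \<psi> t) / (y - t)"
      unfolding eventually_at_filter
      using mono_onD[OF psi_incr] t
      by (intro always_eventually allI impI) (auto simp: zero_le_divide_iff not_le linorder_neq_iff less_imp_le)
    \<comment> \<open>A bound passes to the limit only if \<open>t\<close> is not isolated; points
      to its right suffice, also at \<open>t = a\<close>.\<close>
    moreover have "at t within {a..} \<noteq> bot"
    proof -
      have "{t<..} \<subseteq> {a..}" using t by auto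
      from at_le[OF this, of t] show ?thesis
        using trivial_limit_at_right_real[of t] by (auto simp: bot.extremum_unique)
    qed
    ultimately have "\<psi>' t \<ge> 0"
      by (rule tendsto_lowerbound)
    with psi'_nz[OF t] show ?thesis by linarith
  qed
  then interpret psi_function a \<alpha> \<psi> \<psi>'
    by unfold_locales (use alpha psi_deriv in auto)

  \<comment> \<open>The operator whose fixed points are the solutions\<close>
  define W where "W = ml_weight a \<psi> \<alpha> \<xi>"
  define I where "I x t = psi_integral a \<psi> \<psi>' \<alpha> t (\<lambda>s. k t s (x s))" for x t
  define T where "T x t = f t (x t) (I x t)" for x t
  define q where "q = M * (1 + 1 / \<delta>)"
  have q: "0 \<le> q" "q < 1" using params contr by (auto simp: q_def)
  have W_cont: "continuous_on {a..} W"
    unfolding W_def by (rule ml_weight_continuous_on[OF alpha(2)])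
  have W_pos: "W t > 0" for t
    using mittag_leffler_ge_1[OF alpha, of "\<xi> * (\<psi> t - \<psi> a) powr \<alpha>"] params(2)
    by (simp add: W_def ml_weight_def)
  \<comment> \<open>Positivity of \<open>W\<close> turns the bounded quotient into a bound by a
    multiple of \<open>W\<close>, the form used in the contraction lemmas.\<close>
  have C_space_iff: "x \<in> C_space N a \<psi> \<alpha> \<xi> \<longleftrightarrow>
      x \<in> extensional {a..} \<and> continuous_on {a..} x \<and> (\<exists>C. \<forall>t\<ge>a. N (x t) \<le> C * W t)" for x
    using W_pos by (auto simp: C_space_def bdd_above_def W_def[symmetric] pos_divide_le_eq)

  have k_comp: "continuous_on {(t, s). a \<le> s \<and> s \<le> t} (\<lambda>(t, s). k t s (x s))"
    if x: "continuous_on {a..} x" for x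
  proof -
    have "continuous_on {(t, s). a \<le> s \<and> s \<le> t} (\<lambda>p. x (snd p))"
      by (rule continuous_on_compose2[OF x]) (auto intro: continuous_on_snd continuous_on_id)
    hence "continuous_on {(t, s). a \<le> s \<and> s \<le> t} (\<lambda>p. (fst p, snd p, x (snd p)))"
      by (intro continuous_on_Pair continuous_on_fst continuous_on_snd continuous_on_id)
    from continuous_on_compose2[OF k_cont this] show ?thesis
      by (simp add: case_prod_unfold image_subset_iff)
  qed
  have k_slice: "continuous_on {a..t} (\<lambda>s. k t s (x s))" if x: "continuous_on {a..} x" for x t
  proof -
    have "continuous_on {a..t} (\<lambda>s. (t, s))" by (intro continuous_intros)
    from continuous_on_compose2[OF k_comp[OF x] this] show ?thesis
      by (simp add: image_subset_iff)
  qed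
  have T_cont: "continuous_on {a..} (T x)" if x: "continuous_on {a..} x" for x
  proof -
    have "continuous_on {a..} (I x)"
      unfolding I_def by (rule psi_integral_continuous_on[OF k_comp[OF x]])
    hence "continuous_on {a..} (\<lambda>t. (t, x t, I x t))"
      by (intro continuous_on_Pair continuous_on_id x)
    from continuous_on_compose2[OF f_cont this] show ?thesis
      unfolding T_def by (simp add: image_subset_iff)
  qed

  \<comment> \<open>The contraction estimate\<close>
  have T_contr: "N (T x t - T y t) \<le> C * q * W t"
    if x: "continuous_on {a..} x" and y: "continuous_on {a..} y" and C: "C \<ge> 0"
      and xy: "\<And>t. t \<ge> a \<Longrightarrow> N (x t - y t) \<le> C * W t" and t: "t \<ge> a" for x y C t
  proof -
    have d_cont: "continuous_on {a..t} (\<lambda>s. k t s (x s) - k t s (y s))"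
      by (intro continuous_on_diff k_slice x y)
    have "I x t - I y t = psi_integral a \<psi> \<psi>' \<alpha> t (\<lambda>s. k t s (x s) - k t s (y s))"
      unfolding I_def by (rule psi_integral_diff[OF t k_slice[OF x] k_slice[OF y]])
    hence "N (I x t - I y t) \<le> psi_integral a \<psi> \<psi>' \<alpha> t (\<lambda>s. N (k t s (x s) - k t s (y s)))"
      using is_norm_psi_integral_le[OF norm t d_cont] by simp
    also have "\<dots> \<le> psi_integral a \<psi> \<psi>' \<alpha> t (\<lambda>s. L * C * W s)"
    proof (rule psi_integral_mono[OF t])
      show "continuous_on {a..t} (\<lambda>s. N (k t s (x s) - k t s (y s)))"
        by (rule continuous_on_compose2[OF is_norm_continuous_on[OF norm] d_cont]) auto
      show "continuous_on {a..t} (\<lambda>s. L * C * W s)"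
        by (intro continuous_on_mult_left continuous_on_subset[OF W_cont]) auto
      fix s assume s: "s \<in> {a..t}"
      have "N (k t s (x s) - k t s (y s)) \<le> L * N (x s - y s)"
        using s by (intro k_lip) auto
      also have "\<dots> \<le> L * (C * W s)"
        using s params(1) by (intro mult_left_mono xy) auto
      finally show "N (k t s (x s) - k t s (y s)) \<le> L * C * W s" by (simp add: mult_ac)
    qed
    also have "\<dots> = L * C * psi_integral a \<psi> \<psi>' \<alpha> t W"
      by (rule psi_integral_cmult)
    also have "\<dots> \<le> L * C * (W t / \<xi>)"
      using params(1) C unfolding W_def
      by (intro mult_left_mono psi_integral_ml_weight_le t alpha params) auto
    \<comment> \<open>Here \<open>\<xi> = L * \<delta>\<close> cancels \<open>L\<close>.\<close>
    also have "\<dots> = C * W t / \<delta>"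
      using params by simp
    finally have I_le: "N (I x t - I y t) \<le> C * W t / \<delta>" .
    have "N (T x t - T y t) \<le> M * (N (x t - y t) + N (I x t - I y t))"
      unfolding T_def by (rule f_lip[OF t])
    also have "\<dots> \<le> M * (C * W t + C * W t / \<delta>)"
      by (intro mult_left_mono add_mono xy t I_le params)
    also have "\<dots> = C * q * W t" by (simp add: q_def field_simps)
    finally show ?thesis .
  qed

  \<comment> \<open>Existence and uniqueness\<close>
  obtain B where B: "\<And>t. t \<ge> a \<Longrightarrow> 1 / W t * N (T (\<lambda>_. 0) t) \<le> B"
    using d1_finite unfolding bdd_above_def T_def I_def W_def by auto
  \<comment> \<open>\<open>T\<close> at the zero function is the expression in the hypothesis on
    \<open>d\<^sub>1\<close>. The absolute value supplies the nonnegative constant required for the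
    iteration.\<close>
  have T0: "N (T (\<lambda>_. 0) t) \<le> \<bar>B\<bar> * W t" if "t \<ge> a" for t
  proof -
    have "N (T (\<lambda>_. 0) t) \<le> B * W t" using B[OF that] W_pos[of t] by (simp add: pos_divide_le_eq)
    also have "\<dots> \<le> \<bar>B\<bar> * W t" using W_pos[of t] by (intro mult_right_mono) auto
    finally show ?thesis .
  qed
  obtain x C where x: "continuous_on {a..} x" "C \<ge> 0" "\<And>t. t \<ge> a \<Longrightarrow> N (x t) \<le> C * W t"
    "\<And>t. t \<ge> a \<Longrightarrow> x t = T x t"
    using weighted_contraction_exists[where a = a and W = W and T = T and d = "\<bar>B\<bar>", OF norm q W_cont T_cont T_contr abs_ge_zero T0] by blast
  \<comment> \<open>Elements of the space are extensional. Restricting keeps the fixed point, since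
    \<open>T\<close> at \<open>t\<close> reads only values on \<open>{a..t}\<close>.\<close>
  define x' where "x' = restrict x {a..}"
  have T_cong: "T x' t = T x t" if "t \<ge> a" for t
  proof -
    have "I x' t = I x t"
      unfolding I_def psi_integral_def x'_def
      by (intro arg_cong[where f = "\<lambda>v. (1 / Gamma \<alpha>) *\<^sub>R v"] integral_cong) auto
    with that show ?thesis by (simp add: T_def x'_def)
  qed
  have "continuous_on {a..} x'"
    using x(1) by (subst continuous_on_cong[OF refl, of _ _ x]) (auto simp: x'_def)
  hence "x' \<in> C_space N a \<psi> \<alpha> \<xi>"
    unfolding C_space_iff using x(3) by (auto simp: x'_def)
  moreover have "x' t = T x' t" if "t \<ge> a" for t
    using x(4)[OF that] T_cong[OF that] that by (simp add: x'_def)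
  moreover have "y = z"
    if y: "y \<in> C_space N a \<psi> \<alpha> \<xi>" "\<And>t. t \<ge> a \<Longrightarrow> y t = T y t"
      and z: "z \<in> C_space N a \<psi> \<alpha> \<xi>" "\<And>t. t \<ge> a \<Longrightarrow> z t = T z t" for y z
  proof -
    obtain C\<^sub>1 C\<^sub>2 where C: "\<And>t. t \<ge> a \<Longrightarrow> N (y t) \<le> C\<^sub>1 * W t" "\<And>t. t \<ge> a \<Longrightarrow> N (z t) \<le> C\<^sub>2 * W t"
      using y(1) z(1) unfolding C_space_iff by blast
    \<comment> \<open>Two members of the space have finite weighted distance, which starts the
      uniqueness argument.\<close>
    have le: "N (y t - z t) \<le> \<bar>C\<^sub>1 + C\<^sub>2\<bar> * W t" if t: "t \<ge> a" for t
    proof -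
      have "N (y t - z t) \<le> N (y t) + N (z t)"
        using is_norm_diff_triangle[OF norm, of "y t" "z t" 0] is_norm_minus_commute[OF norm, of 0 "z t"]
        by simp
      also have "\<dots> \<le> (C\<^sub>1 + C\<^sub>2) * W t"
        using C(1)[OF t] C(2)[OF t] by (simp add: algebra_simps)
      also have "\<dots> \<le> \<bar>C\<^sub>1 + C\<^sub>2\<bar> * W t" using W_pos[of t] by (intro mult_right_mono) auto
      finally show ?thesis .
    qed
    show ?thesis
    proof (rule extensionalityI)
      show "y \<in> extensional {a..}" "z \<in> extensional {a..}"
        using y(1) z(1) by (auto simp: C_space_iff)
      fix t assume "t \<in> {a..}"
      thus "y t = z t"
        using y z
        by (intro weighted_contraction_unique[where a = a and W = W and T = T
              and C = "\<bar>C\<^sub>1 + C\<^sub>2\<bar>", OF norm q T_contr _ y(2) _ z(2) abs_ge_zero le])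
           (auto simp: C_space_iff)
    qed
  qed
  ultimately show ?thesis
    unfolding T_def I_def by (intro ex1I[of _ x']) blast+
qed

end
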